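(* Let $\boldsymbol{p} = (p_i)_{i\ge 1}$ be any sequence of numbers $p_i \in [0,1)$ with $0 < \lambda := \sum_{i\ge 1} p_i < \infty$, and let $p_* := \max_{i \ge 1} p_i$. Let $Q$ be the distribution of $X = \sum_{i\ge 1} Z_i$, where $Z_1, Z_2, \ldots$ are independent Bernoulli random variables with $\mathbb{P}(Z_i = 1) = p_i$, and let $\mathrm{Poiss}_\lambda$ be the Poisson distribution with parameter $\lambda$. Then $$\rho(Q, \mathrm{Poiss}_\lambda) \ \le \ (1 - p_* )^{-1}.$$
   Context: Since $\sum_i p_i < \infty$, the sum $X$ is almost surely finite. For integers $x \ge 0$ let $b(x) := \mathbb{P}(X = x)$, explicitly $$b(x) = \sum_{J \subset \mathbb{N},\, \#J = x} \ \prod_{i\in J} p_i \prod_{k \in \mathbb{N}\setminus J} (1 - p_k), \qquad \mathbb{N} = \{1,2,3,\ldots\},$$ and let $\pi(x) := e^{-\lambda}\lambda^x/x!$. The maximal density ratio is $$\rho(Q,\mathrm{Poiss}_\lambda) := \sup_{x \ge 0} \frac{b(x)}{\pi(x)},$$ where the supremum is over all integers $x \ge 0$. The maximum $p_*$ is attained because $p_i \to 0$. *)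

theory Defs
  imports "HOL-Probability.Probability"
begin

(* Poiss_lambda charges every point, so the conventions for 0/0 and x/0 play no role here;
   values in ennreal because the supremum is not known to be finite a priori. *)
definition max_density_ratio :: "nat measure \<Rightarrow> nat measure \<Rightarrow> ennreal" where
  "max_density_ratio Q P = (SUP x. emeasure Q {x} / emeasure P {x})"

(* Max is unsuitable since the range may be infinite; max_seq_attained below shows that
   the maximum exists for summable sequences. *)
definition max_seq :: "(nat \<Rightarrow> real) \<Rightarrow> real" where
  "max_seq p = (GREATEST t. t \<in> range p)"

(* The infinite sum of naturals is the library one in the discrete topology: on sample points
   where infinitely many Z i are nonzero it is an unspecified constant. When the success
   probabilities are summable this is a null event, see AE_bernoulli_sum_sums. *)
definition bernoulli_sum_distr :: "'a measure \<Rightarrow> (nat \<Rightarrow> 'a \<Rightarrow> nat) \<Rightarrow> nat measure" where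
  "bernoulli_sum_distr M Z = distr M (count_space UNIV) (\<lambda>\<omega>. \<Sum>i. Z i \<omega>)"

lemma max_seq_attained:
  fixes p :: "nat \<Rightarrow> real"
  assumes nonneg: "\<And>i. 0 \<le> p i" and sm: "summable p"
  shows "max_seq p \<in> range p" and "p i \<le> max_seq p"
proof -
  have "\<exists>j. \<forall>i. p i \<le> p j"
  proof (cases "\<exists>k. p k > 0")
    case False
    then show ?thesis using nonneg by (meson le_less_trans not_le)
  next
    case True
    then obtain k where k: "p k > 0" by blast
    have "eventually (\<lambda>i. p i < p k) sequentially"
      using summable_LIMSEQ_zero[OF sm] k by (rule order_tendstoD(2))
    then obtain N where N: "\<And>i. i \<ge> N \<Longrightarrow> p i < p k"
      by (auto simp: eventually_sequentially)
    define A where "A = insert k {..<N}"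
    have A: "finite A" "k \<in> A" by (auto simp: A_def)
    then have "Max (p ` A) \<in> p ` A" by (intro Max_in) auto
    then obtain j where j: "p j = Max (p ` A)" by auto
    have "p i \<le> p j" for i
    proof (cases "i \<in> A")
      case True
      then show ?thesis using A j by simp
    next
      case False
      then have "p i < p k" using N by (auto simp: A_def not_less)
      also have "p k \<le> p j" using A j by simp
      finally show ?thesis by simp
    qed
    then show ?thesis by blast
  qed
  then obtain j where j: "\<And>i. p i \<le> p j" by blast
  have "max_seq p = p j"
    unfolding max_seq_def by (rule Greatest_equality) (use j in auto)
  then show "max_seq p \<in> range p" and "p i \<le> max_seq p" using j by auto
qed

lemma sums_nat_iff:
  fixes f :: "nat \<Rightarrow> nat"
  shows "f sums s \<longleftrightarrow> (\<exists>N. \<forall>n\<ge>N. (\<Sum>i<n. f i) = s)"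
  by (simp add: sums_def tendsto_discrete eventually_sequentially)

lemma measurable_nat_suminf:
  fixes Z :: "nat \<Rightarrow> 'a \<Rightarrow> nat"
  assumes [measurable]: "\<And>i. Z i \<in> measurable M (count_space UNIV)"
  shows "(\<lambda>\<omega>. \<Sum>i. Z i \<omega>) \<in> measurable M (count_space UNIV)"
proof -
  have "(\<lambda>\<omega>. \<Sum>i. Z i \<omega>) -` {k} \<inter> space M \<in> sets M" for k :: nat
  proof -
    have eq: "(\<Sum>i. Z i \<omega>) = k \<longleftrightarrow>
        (\<exists>N. \<forall>n\<ge>N. (\<Sum>i<n. Z i \<omega>) = k) \<or>
        (\<not> (\<exists>s. \<exists>N. \<forall>n\<ge>N. (\<Sum>i<n. Z i \<omega>) = s)) \<and> k = (THE s :: nat. False)" for \<omega>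
      unfolding sums_nat_iff[symmetric]
    proof (cases "\<exists>s. (\<lambda>i. Z i \<omega>) sums s")
      case True
      then show "(\<Sum>i. Z i \<omega>) = k \<longleftrightarrow> (\<lambda>i. Z i \<omega>) sums k \<or>
          \<not> (\<exists>s. (\<lambda>i. Z i \<omega>) sums s) \<and> k = (THE s. False)"
        by (metis sums_unique)
    next
      case False
      then show "(\<Sum>i. Z i \<omega>) = k \<longleftrightarrow> (\<lambda>i. Z i \<omega>) sums k \<or>
          \<not> (\<exists>s. (\<lambda>i. Z i \<omega>) sums s) \<and> k = (THE s. False)"
        by (auto simp: suminf_def)
    qed
    have "{\<omega> \<in> space M. (\<Sum>i. Z i \<omega>) = k} \<in> sets M"
      unfolding eq by measurable
    then show ?thesis
      by (simp add: vimage_def Int_def conj_commute)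
  qed
  then show ?thesis
    by (simp add: measurable_count_space_eq2_countable)
qed

lemma AE_bernoulli_sum_sums:
  fixes Z :: "nat \<Rightarrow> 'a \<Rightarrow> nat"
  assumes "prob_space M" and [measurable]: "\<And>i. Z i \<in> measurable M (count_space UNIV)"
    and p: "\<And>i. 0 \<le> p i" "\<And>i. p i \<le> 1" "summable p"
    and distr: "\<And>i. distr M (count_space UNIV) (Z i) =
          measure_pmf (map_pmf of_bool (bernoulli_pmf (p i)))"
  shows "AE \<omega> in M. (\<lambda>i. Z i \<omega>) sums (\<Sum>i. Z i \<omega>)"
proof -
  interpret prob_space M by fact
  define A where "A i = {\<omega> \<in> space M. Z i \<omega> \<noteq> 0}" for i
  have meas: "A i \<in> sets M" for i unfolding A_def by measurable
  have "measure M (A i) = p i" for i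
  proof -
    have "measure M (A i) = measure (distr M (count_space UNIV) (Z i)) {n. n \<noteq> 0}"
      by (subst measure_distr) (auto simp: A_def intro!: arg_cong[where f = "measure M"])
    also have "\<dots> = measure (measure_pmf (bernoulli_pmf (p i))) {True}"
      unfolding distr by (auto simp: measure_map_pmf vimage_def of_bool_def
        intro!: arg_cong[where f = "measure _"])
    also have "\<dots> = p i" using p by (simp add: measure_pmf_single)
    finally show ?thesis .
  qed
  then have "AE \<omega> in M. eventually (\<lambda>n. \<omega> \<in> space M - A n) sequentially"
    using p meas by (intro borel_cantelli_AE1) (auto simp: emeasure_eq_measure)
  then show ?thesis
  proof eventually_elim
    case (elim \<omega>)
    then obtain N where "\<And>n. n \<ge> N \<Longrightarrow> Z n \<omega> = 0"
      by (auto simp: eventually_sequentially A_def)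
    then have "(\<lambda>i. Z i \<omega>) sums (\<Sum>i<N. Z i \<omega>)"
      by (intro sums_finite) auto
    then show ?case by (simp add: sums_iff)
  qed
qed

end

theory Submission
  imports Defs
begin

text \<open>
  The idea is to deform the success probabilities from $0$ to $p_i$ and to watch the density
  ratio grow. For finitely many summands and $t \in [0,1]$, replace $p_i$ by $t p_i$ and
  $\lambda$ by $t \lambda$, and let $r_k(t)$ be the resulting density ratio at $k$. Up to the
  factor $t^k$, the probability of the value $k$ is the coefficient $B_k(t)$ of $z^k$ in
  $\prod_i (1 - t p_i + p_i z)$, so that $r_k(t) = e^{t\lambda} k! B_k(t) / \lambda^k$,
  which makes sense at $t = 0$ too. Since the product depends on $t$ and $z$ through
  $p_i (z - t)$ only, $B_k' = - (k+1) B_{k+1}$, and hence $r_k' = \lambda (r_k - r_{k+1})$.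

  The combinatorial core is \<open>thinned_coeff_ratio_gap\<close>, an inequality converse to
  Newton's: the ratios $k B_k / B_{k-1}$ decrease in $k$, but by at most
  $m = q / (1 - t q)$ at each step, when $p_i \le q$ for all $i$. In terms of $r$ it reads
  $\lambda r_k^2 \le \lambda r_{k+1} r_{k-1} + m r_k r_{k-1}$. So whenever
  $r_{k-1}(t) \le r_k(t)$, it gives $r_k' \le m r_k$, which says exactly that
  $r_k(t) (1 - t q)$ is not increasing at $t$. Thus $r_k(t) (1 - t q)$ can grow only while it
  lies below $r_{k-1}(t) (1 - t q)$. It starts out there, as
  $r_k(0) \le r_{k-1}(0)$, and so induction on $k$ bounds all of these functions by $1$
  (\<open>thinned_ratio_bound\<close>, by way of \<open>crossing_bound\<close>). At $t = 1$ this is the theorem for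
  finite sums. The partial sums of the $Z_i$ are almost surely eventually equal to the infinite
  sum, so their point probabilities converge and the bound carries over.
\<close>

section \<open>Coefficients of the thinned generating function\<close>

text \<open>
  At $t = 1$ this is the probability generating function of $Z_0 + \dots + Z_{n-1}$. In general
  the parameter scales the failure terms only: this is the generating function for the success
  probabilities $t p_i$ evaluated at $z / t$, a polynomial in $t$ that does not degenerate
  at $t = 0$.
\<close>
definition thinned_pgf :: "(nat \<Rightarrow> real) \<Rightarrow> real \<Rightarrow> nat \<Rightarrow> real poly" where
  "thinned_pgf p t n = (\<Prod>i<n. [:1 - t * p i, p i:])"

abbreviation thinned_coeff :: "(nat \<Rightarrow> real) \<Rightarrow> real \<Rightarrow> nat \<Rightarrow> nat \<Rightarrow> real" where
  "thinned_coeff p t n k \<equiv> coeff (thinned_pgf p t n) k"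

lemma thinned_coeff_0 [simp]: "thinned_coeff p t 0 k = (if k = 0 then 1 else 0)"
  by (simp add: thinned_pgf_def)

lemma thinned_coeff_Suc:
  "thinned_coeff p t (Suc n) k = (1 - t * p n) * thinned_coeff p t n k
    + p n * (if k = 0 then 0 else thinned_coeff p t n (k - 1))"
  by (cases k) (simp_all add: thinned_pgf_def mult_pCons_right)

text \<open>
  Each factor $1 + p_i (z - t)$ depends on $z - t$ only, so differentiating in $t$ is the same as
  differentiating in $z$ up to sign.
\<close>
lemma DERIV_thinned_coeff:
  "((\<lambda>t. thinned_coeff p t n k) has_real_derivative
    - (real (Suc k) * thinned_coeff p t n (Suc k))) (at t)"
proof (induction n arbitrary: k)
  case 0
  then show ?case by simp
next
  case (Suc n)
  have *: "((\<lambda>t. if k = 0 then 0 else thinned_coeff p t n (k - 1)) has_real_derivative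
      - (real k * thinned_coeff p t n k)) (at t)"
    using Suc[of "k - 1"] by (cases k) auto
  show ?case
    unfolding thinned_coeff_Suc
    by (rule derivative_eq_intros Suc * refl)+ (simp add: algebra_simps)
qed

section \<open>Consecutive ratios of coefficients\<close>

text \<open>
  The two following lemmas are inductive steps for multiplying a polynomial by $c + d z$: if
  $a, b, y, z$ are four consecutive coefficients, then $c b + d a$, $c y + d b$ and $c z + d y$
  are consecutive coefficients of the product. Here the mixed term needs
  $a z \le b y$, the product of the two log-concavity assumptions divided by $b y$; the assumption
  that there are no internal zeros covers $b y = 0$.
\<close>
lemma log_concave_step:
  fixes a b y z c d :: real
  assumes nn: "0 \<le> a" "0 \<le> b" "0 \<le> y" "0 \<le> z" "0 \<le> c" "0 \<le> d"
    and lc: "a * y \<le> b\<^sup>2" "b * z \<le> y\<^sup>2"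
    and zero: "b = 0 \<Longrightarrow> y = 0" "y = 0 \<Longrightarrow> z = 0"
  shows "(c * b + d * a) * (c * z + d * y) \<le> (c * y + d * b)\<^sup>2"
proof -
  have *: "a * z \<le> b * y"
  proof (cases "y = 0")
    case True
    then show ?thesis using zero by simp
  next
    case False
    then have "0 < b * y" using nn zero by force
    moreover have "(a * y) * (b * z) \<le> b\<^sup>2 * y\<^sup>2"
      using lc nn by (intro mult_mono) auto
    then have "(a * z) * (b * y) \<le> (b * y) * (b * y)"
      by (simp add: power2_eq_square mult_ac)
    ultimately show ?thesis by (simp add: mult_le_cancel_right)
  qed
  have "0 \<le> c\<^sup>2 * (y\<^sup>2 - b * z) + c * d * (b * y - a * z) + d\<^sup>2 * (b\<^sup>2 - a * y)"
    using nn lc * by (intro add_nonneg_nonneg mult_nonneg_nonneg) auto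
  also have "\<dots> = (c * y + d * b)\<^sup>2 - (c * b + d * a) * (c * z + d * y)"
    by (simp add: power2_eq_square algebra_simps)
  finally show ?thesis by simp
qed

text \<open>
  Compare powers of $c$ and $d$. The $c^2$ terms are the second assumption on gaps. The first one
  covers the $d^2$ terms except for $d^2 (b^2 - a y)$, because its factors $x - 1$ and $x$ are
  too small by $1$. By log-concavity this excess is at most $m c d (b^2 - a y)$. It is
  charged to the $c d$ terms, and what remains of them is the bound $2 m$ for the decrease of the
  ratio over two steps.
\<close>
lemma ratio_gap_step:
  fixes a b y z c d m x :: real
  assumes nn: "0 \<le> a" "0 \<le> b" "0 \<le> y" "0 \<le> z" "0 \<le> c" "0 \<le> d" "0 \<le> x" "0 \<le> m"
    and lc: "a * y \<le> b\<^sup>2"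
    and gap: "(x - 1) * b\<^sup>2 \<le> x * y * a + m * b * a" "x * y\<^sup>2 \<le> (x + 1) * z * b + m * y * b"
    and m: "d \<le> m * c"
  shows "x * (c * y + d * b)\<^sup>2 \<le> (x + 1) * (c * z + d * y) * (c * b + d * a)
      + m * (c * y + d * b) * (c * b + d * a)"
proof -
  have two_step: "(x - 1) * y * b \<le> (x + 1) * z * a + 2 * m * y * a"
  proof (cases "b = 0")
    case True
    then show ?thesis using nn by simp
  next
    case False
    have "y * ((x - 1) * b\<^sup>2) + a * (x * y\<^sup>2)
        \<le> y * (x * y * a + m * b * a) + a * ((x + 1) * z * b + m * y * b)"
      using gap nn by (intro add_mono mult_left_mono)
    then have "((x - 1) * y * b) * b \<le> ((x + 1) * z * a + 2 * m * y * a) * b"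
      by (simp add: power2_eq_square algebra_simps)
    then show ?thesis using False nn by (simp add: mult_le_cancel_right)
  qed
  have "d * d * (b\<^sup>2 - a * y) \<le> d * (m * c) * (b\<^sup>2 - a * y)"
    using m lc nn by (intro mult_right_mono mult_left_mono) auto
  moreover have "0 \<le> c\<^sup>2 * ((x + 1) * z * b + m * y * b - x * y\<^sup>2)
      + c * d * ((x + 1) * z * a + 2 * m * y * a - (x - 1) * y * b)
      + d\<^sup>2 * (x * y * a + m * b * a - (x - 1) * b\<^sup>2)"
    using nn gap two_step by (intro add_nonneg_nonneg mult_nonneg_nonneg) auto
  ultimately show ?thesis
    by (simp add: power2_eq_square algebra_simps)
qed

context
  fixes p :: "nat \<Rightarrow> real" and q t :: real
  assumes p: "\<And>i. 0 \<le> p i" "\<And>i. p i \<le> q" and q: "q < 1" and t: "0 \<le> t" "t \<le> 1"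
begin

lemma thinning_factor: "0 < 1 - t * q" "1 - t * q \<le> 1 - t * p i"
proof -
  have "0 \<le> q" using p[of 0] by simp
  then have "t * q \<le> 1 * q" using t by (intro mult_right_mono)
  then show "0 < 1 - t * q" using q by simp
  show "1 - t * q \<le> 1 - t * p i" using p t by (simp add: mult_left_mono)
qed

lemma thinning_factor_pos: "0 < 1 - t * p i"
  using thinning_factor less_le_trans by blast

lemma thinned_coeff_nonneg: "0 \<le> thinned_coeff p t n k"
proof (induction n arbitrary: k)
  case (Suc n)
  then show ?case
    using thinning_factor_pos[of n] p(1)[of n] by (simp add: thinned_coeff_Suc)
qed simp

lemma thinned_coeff_zero_Suc:
  "thinned_coeff p t n k = 0 \<Longrightarrow> thinned_coeff p t n (Suc k) = 0"
proof (induction n arbitrary: k)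
  case (Suc n)
  have "0 \<le> p n * (if k = 0 then 0 else thinned_coeff p t n (k - 1))"
    using p(1) thinned_coeff_nonneg by simp
  moreover have "0 \<le> (1 - t * p n) * thinned_coeff p t n k"
    using thinning_factor_pos[of n] thinned_coeff_nonneg by simp
  ultimately have "(1 - t * p n) * thinned_coeff p t n k = 0"
    using Suc.prems unfolding thinned_coeff_Suc by linarith
  then have "thinned_coeff p t n k = 0"
    using thinning_factor_pos[of n] by simp
  then show ?case
    using Suc.IH[of k] by (simp add: thinned_coeff_Suc)
qed (simp split: if_splits)

lemma thinned_coeff_log_concave:
  "thinned_coeff p t n k * thinned_coeff p t n (Suc (Suc k)) \<le> (thinned_coeff p t n (Suc k))\<^sup>2"
proof (induction n arbitrary: k)
  case (Suc n)
  have lc: "(if k = 0 then 0 else thinned_coeff p t n (k - 1)) * thinned_coeff p t n (Suc k)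
      \<le> (thinned_coeff p t n k)\<^sup>2"
    using Suc[of "k - 1"] by (cases k) auto
  have "((1 - t * p n) * thinned_coeff p t n k
        + p n * (if k = 0 then 0 else thinned_coeff p t n (k - 1))) *
      ((1 - t * p n) * thinned_coeff p t n (Suc (Suc k)) + p n * thinned_coeff p t n (Suc k))
    \<le> ((1 - t * p n) * thinned_coeff p t n (Suc k) + p n * thinned_coeff p t n k)\<^sup>2"
    by (rule log_concave_step)
      (use Suc lc p(1) thinning_factor_pos[of n] thinned_coeff_nonneg
        thinned_coeff_zero_Suc in \<open>auto simp: less_imp_le\<close>)
  then show ?case by (simp add: thinned_coeff_Suc)
qed simp

text \<open>
  Up to the common factor $\prod_i (1 - t p_i)$ the coefficients are the elementary symmetric
  polynomials of the odds $w_i = p_i / (1 - t p_i)$, and $q / (1 - t q)$ bounds all of the odds. The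
  inequality bounds the decrease of the ratio of consecutive coefficients, weighted by
  the index. It is an equality when all $w_i$ coincide with the bound: then the ratio for the
  indices $k$ and $k - 1$ is $(n - k + 1) w$.
\<close>
lemma thinned_coeff_ratio_gap:
  "real (Suc k) * (thinned_coeff p t n (Suc k))\<^sup>2
    \<le> real (Suc (Suc k)) * thinned_coeff p t n (Suc (Suc k)) * thinned_coeff p t n k
    + q / (1 - t * q) * thinned_coeff p t n (Suc k) * thinned_coeff p t n k"
proof (induction n arbitrary: k)
  case (Suc n)
  \<comment> \<open>The coefficient preceding number $k$, with $0$ in front of the constant one. For $k = 0$ the
    gap inequality at the preceding index is then trivial because its factor is $0$ as well.\<close>
  define u where "u = (if k = 0 then 0 else thinned_coeff p t n (k - 1))"
  have u: "0 \<le> u" using thinned_coeff_nonneg by (simp add: u_def)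
  have lc: "u * thinned_coeff p t n (Suc k) \<le> (thinned_coeff p t n k)\<^sup>2"
    using thinned_coeff_log_concave[of n "k - 1"] by (cases k) (auto simp: u_def)
  have gap: "(real (Suc k) - 1) * (thinned_coeff p t n k)\<^sup>2
      \<le> real (Suc k) * thinned_coeff p t n (Suc k) * u
      + q / (1 - t * q) * thinned_coeff p t n k * u"
    using Suc[of "k - 1"] by (cases k) (auto simp: u_def)
  have q0: "0 \<le> q" using p[of 0] by simp
  have "q / (1 - t * q) * (1 - t * p n) \<ge> q / (1 - t * q) * (1 - t * q)"
    using thinning_factor(1) thinning_factor(2)[of n] q0 by (intro mult_left_mono) auto
  then have m: "p n \<le> q / (1 - t * q) * (1 - t * p n)"
    using thinning_factor(1) p(2)[of n] by simp
  have "real (Suc k) * ((1 - t * p n) * thinned_coeff p t n (Suc k) + p n * thinned_coeff p t n k)\<^sup>2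
    \<le> (real (Suc k) + 1) *
        ((1 - t * p n) * thinned_coeff p t n (Suc (Suc k)) + p n * thinned_coeff p t n (Suc k)) *
        ((1 - t * p n) * thinned_coeff p t n k + p n * u)
    + q / (1 - t * q) * ((1 - t * p n) * thinned_coeff p t n (Suc k) + p n * thinned_coeff p t n k) *
        ((1 - t * p n) * thinned_coeff p t n k + p n * u)"
    by (rule ratio_gap_step)
     (use Suc[of k] u lc gap m q0 p(1) thinning_factor(1) thinning_factor_pos[of n]
      thinned_coeff_nonneg in \<open>auto simp: less_imp_le add_ac\<close>)
  then show ?case by (simp add: thinned_coeff_Suc u_def add_ac)
qed simp

end

text \<open>
  At $t = 0$ the coefficients are the elementary symmetric polynomials of the $p_i$. The inequality
  holds because a set of $k$ indices together with a further index counts each set of $k + 1$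
  indices $k + 1$ times; the surplus on the right consists of the pairs in which the index belongs
  to the set. This gives $r_{k+1}(0) \le r_k(0)$ for the density ratios.
\<close>
lemma thinned_coeff_at_0_le:
  assumes p: "\<And>i. 0 \<le> p i"
  shows "real (Suc k) * thinned_coeff p 0 n (Suc k) \<le> (\<Sum>i<n. p i) * thinned_coeff p 0 n k"
proof (induction n arbitrary: k)
  case (Suc n)
  have nn: "0 \<le> thinned_coeff p 0 n j" for j n
    by (induction n arbitrary: j) (auto simp: thinned_coeff_Suc p)
  define u where "u = (if k = 0 then 0 else thinned_coeff p 0 n (k - 1))"
  have u0: "0 \<le> u" by (simp add: u_def nn)
  have u: "real k * thinned_coeff p 0 n k \<le> (\<Sum>i<n. p i) * u"
    using Suc[of "k - 1"] by (cases k) (auto simp: u_def)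
  have "real (Suc k) * thinned_coeff p 0 (Suc n) (Suc k)
      = real (Suc k) * thinned_coeff p 0 n (Suc k) + p n * thinned_coeff p 0 n k
        + p n * (real k * thinned_coeff p 0 n k)"
    by (simp add: thinned_coeff_Suc algebra_simps)
  also have "\<dots> \<le> (\<Sum>i<n. p i) * thinned_coeff p 0 n k + p n * thinned_coeff p 0 n k
      + p n * ((\<Sum>i<n. p i) * u)"
    using Suc[of k] u p by (intro add_mono mult_left_mono) auto
  also have "\<dots> \<le> (\<Sum>i<n. p i) * thinned_coeff p 0 n k + p n * thinned_coeff p 0 n k
      + p n * ((\<Sum>i<n. p i) * u) + p n * p n * u"
    using u0 p by simp
  also have "\<dots> = (\<Sum>i<Suc n. p i) * thinned_coeff p 0 (Suc n) k"
    by (simp add: thinned_coeff_Suc u_def algebra_simps)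
  finally show ?case .
qed simp

section \<open>Density ratios of finite sums\<close>

text \<open>
  If \<open>h\<close> exceeds \<open>g\<close> at time \<open>t\<close>, go back to the last time when it did not. Since then \<open>h\<close> has not
  increased, and at that time it was bounded by \<open>g\<close>.
\<close>
lemma crossing_bound:
  fixes g h h' :: "real \<Rightarrow> real"
  assumes t: "0 \<le> t"
    and cont: "continuous_on {0..t} g"
    and deriv: "\<And>s. s \<in> {0..t} \<Longrightarrow> (h has_real_derivative h' s) (at s)"
    and start: "h 0 \<le> g 0"
    and decr: "\<And>s. s \<in> {0..t} \<Longrightarrow> g s \<le> h s \<Longrightarrow> h' s \<le> 0"
    and bound: "\<And>s. s \<in> {0..t} \<Longrightarrow> g s \<le> C"
  shows "h t \<le> C"
proof -
  have conth: "continuous_on {0..t} h"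
    by (intro continuous_at_imp_continuous_on ballI DERIV_isCont[OF deriv])
  define A where "A = {s \<in> {0..t}. h s \<le> g s}"
  have "closed A"
    unfolding A_def by (intro continuous_on_closed_Collect_le conth cont closed_atLeastAtMost)
  moreover have "0 \<in> A" and bdd: "bdd_above A"
    using t start by (auto simp: A_def)
  ultimately have s: "Sup A \<in> A"
    by (intro closed_contains_Sup) auto
  define s where "s = Sup A"
  have above: "g r \<le> h r" if "s < r" "r \<le> t" for r
    using cSup_upper[OF _ bdd, of r] that s by (force simp: A_def s_def)
  have "h t \<le> h s"
  proof (cases "s = t")
    case False
    then have "s < t" using s by (auto simp: A_def s_def)
    moreover have s0: "0 \<le> s" using s by (auto simp: A_def s_def)
    moreover have "\<exists>y. (h has_real_derivative y) (at r) \<and> y \<le> 0" if "s < r" "r < t" for r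
      using deriv[of r] decr[of r] above[of r] s0 that by auto
    moreover have "continuous_on {s..t} h"
      using continuous_on_subset[OF conth] s0 by simp
    ultimately show ?thesis
      by (intro DERIV_nonpos_imp_decreasing_open[of s t h] less_imp_le)
  qed simp
  also have "\<dots> \<le> C"
    using s bound[of s] by (auto simp: A_def s_def)
  finally show ?thesis .
qed

text \<open>
  The induction on \<open>k\<close> runs over all \<open>t\<close> at once, because the crossing time of the curves for \<open>k\<close> and
  \<open>Suc k\<close> may lie anywhere before \<open>t\<close>. The value for $k = 0$ is at most $1$ by
  $1 - x \le e^{-x}$.
\<close>
lemma thinned_ratio_bound:
  fixes p :: "nat \<Rightarrow> real" and q :: real
  assumes p: "\<And>i. 0 \<le> p i" "\<And>i. p i \<le> q" and q: "q < 1"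
    and lam: "(\<Sum>i<n. p i) = lam" "0 < lam" and t: "0 \<le> t" "t \<le> 1"
  shows "exp (t * lam) * (fact k / lam ^ k * thinned_coeff p t n k) * (1 - t * q) \<le> 1"
  using t
proof (induction k arbitrary: t)
  case 0
  have q0: "0 \<le> q" using p[of 0] by simp
  have pos: "0 \<le> 1 - t * p i" for i
    using thinning_factor_pos[of p q t i] 0 p q by simp
  have "thinned_coeff p t n 0 = (\<Prod>i<n. 1 - t * p i)"
    by (induction n) (simp_all add: thinned_coeff_Suc)
  also have "\<dots> \<le> (\<Prod>i<n. exp (- (t * p i)))"
    using pos exp_ge_add_one_self[of "- (t * p i)" for i] by (intro prod_mono) auto
  also have "\<dots> = exp (- (t * lam))"
    unfolding lam(1)[symmetric] by (simp add: exp_sum[symmetric] sum_negf sum_distrib_left)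
  finally have "exp (t * lam) * thinned_coeff p t n 0 \<le> 1"
    by (simp add: exp_minus field_simps)
  moreover have "0 \<le> exp (t * lam) * thinned_coeff p t n 0"
    using thinned_coeff_nonneg[of p q t n 0] 0 p q by simp
  moreover have "0 \<le> 1 - t * q" "1 - t * q \<le> 1"
    using thinning_factor(1)[of p q t] 0 p q q0 by (auto intro: less_imp_le)
  ultimately show ?case
    using mult_le_one[of "exp (t * lam) * thinned_coeff p t n 0" "1 - t * q"] by simp
next
  case (Suc k)
  define r where "r j s = exp (s * lam) * (fact j / lam ^ j * thinned_coeff p s n j)" for j s
  have dr: "(r j has_real_derivative lam * (r j s - r (Suc j) s)) (at s)" for j s
    unfolding r_def
    by (rule derivative_eq_intros DERIV_thinned_coeff refl)+
      (use lam in \<open>simp add: field_simps\<close>)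
  have "r (Suc k) t * (1 - t * q) \<le> 1"
  proof (rule crossing_bound[where h = "\<lambda>s. r (Suc k) s * (1 - s * q)"
        and t = t and C = 1 and g = "\<lambda>s. r k s * (1 - s * q)"
        and h' = "\<lambda>s. lam * (r (Suc k) s - r (Suc (Suc k)) s) * (1 - s * q) - r (Suc k) s * q"])
    show "0 \<le> t" by fact
    show "continuous_on {0..t} (\<lambda>s. r k s * (1 - s * q))"
      using dr by (intro continuous_intros DERIV_continuous_on[of _ "r k"])
        (blast intro: has_field_derivative_at_within)
    show "((\<lambda>s. r (Suc k) s * (1 - s * q)) has_real_derivative
        lam * (r (Suc k) s - r (Suc (Suc k)) s) * (1 - s * q) - r (Suc k) s * q) (at s)" for s
      by (rule derivative_eq_intros dr refl)+ simp
    show "r (Suc k) 0 * (1 - 0 * q) \<le> r k 0 * (1 - 0 * q)"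
    proof -
      have "fact k / lam ^ Suc k * (real (Suc k) * thinned_coeff p 0 n (Suc k))
          \<le> fact k / lam ^ Suc k * (lam * thinned_coeff p 0 n k)"
        using thinned_coeff_at_0_le[of p k n] p lam by (intro mult_left_mono) auto
      then show ?thesis using lam(2) by (simp add: r_def mult_ac)
    qed
    show "r k s * (1 - s * q) \<le> 1" if "s \<in> {0..t}" for s
      using Suc.IH[of s] Suc.prems that by (simp add: r_def)
    show "lam * (r (Suc k) s - r (Suc (Suc k)) s) * (1 - s * q) - r (Suc k) s * q \<le> 0"
      if s: "s \<in> {0..t}" and le: "r k s * (1 - s * q) \<le> r (Suc k) s * (1 - s * q)" for s
    proof -
      have ctx: "0 \<le> s" "s \<le> 1" using s Suc.prems by auto
      note facts = p q ctx
      have pos: "0 < 1 - s * q" using thinning_factor(1)[of p q s] facts by simp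
      have nn: "0 \<le> r j s" for j
        using thinned_coeff_nonneg[of p q s n j] facts lam by (simp add: r_def)
      have le': "r k s \<le> r (Suc k) s" using le pos by simp
      \<comment> \<open>The factor that turns the gap inequality for the coefficients into one for the ratios.\<close>
      define c where "c = (exp (s * lam))\<^sup>2 * (fact (Suc k) * fact k) / (lam ^ Suc k * lam ^ k)"
      have "c * (real (Suc k) * (thinned_coeff p s n (Suc k))\<^sup>2)
        \<le> c * (real (Suc (Suc k)) * thinned_coeff p s n (Suc (Suc k)) * thinned_coeff p s n k
            + q / (1 - s * q) * thinned_coeff p s n (Suc k) * thinned_coeff p s n k)"
        using thinned_coeff_ratio_gap[of p q s k n] facts lam
        by (intro mult_left_mono) (auto simp: c_def)
      moreover have scale:
        "c * (real (Suc k) * (thinned_coeff p s n (Suc k))\<^sup>2) = lam * (r (Suc k) s)\<^sup>2"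
        "c * (real (Suc (Suc k)) * thinned_coeff p s n (Suc (Suc k)) * thinned_coeff p s n k)
          = lam * r (Suc (Suc k)) s * r k s"
        "c * (q / (1 - s * q) * thinned_coeff p s n (Suc k) * thinned_coeff p s n k)
          = q / (1 - s * q) * r (Suc k) s * r k s"
        using lam(2) by (simp_all add: r_def c_def power2_eq_square mult_ac del: of_nat_Suc)
      ultimately have "lam * (r (Suc k) s)\<^sup>2 \<le> lam * r (Suc (Suc k)) s * r k s
          + q / (1 - s * q) * r (Suc k) s * r k s"
        unfolding distrib_left scale by simp
      then have gap: "lam * (r (Suc k) s)\<^sup>2 * (1 - s * q)
          \<le> (lam * r (Suc (Suc k)) s * (1 - s * q) + q * r (Suc k) s) * r k s"
        using pos by (simp add: field_simps)
      show ?thesis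
      proof (cases "r k s = 0")
        case True
        then have "thinned_coeff p s n k = 0" using lam by (simp add: r_def)
        then have "thinned_coeff p s n (Suc k) = 0"
          using thinned_coeff_zero_Suc[of p q s n k] facts by simp
        then have "r (Suc k) s = 0" by (simp add: r_def)
        then show ?thesis using nn[of "Suc (Suc k)"] lam pos by simp
      next
        case False
        \<comment> \<open>Bound one factor of the square from below by \<open>r k s\<close> and cancel \<open>r k s\<close>.\<close>
        have "(lam * r (Suc k) s * (1 - s * q)) * r k s
            \<le> (lam * r (Suc k) s * (1 - s * q)) * r (Suc k) s"
          using le' nn lam pos by (intro mult_left_mono) auto
        also have "\<dots> = lam * (r (Suc k) s)\<^sup>2 * (1 - s * q)"
          by (simp add: power2_eq_square mult_ac)
        also note gap
        finally have "lam * r (Suc k) s * (1 - s * q)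
            \<le> lam * r (Suc (Suc k)) s * (1 - s * q) + q * r (Suc k) s"
          using False nn[of k] by (simp add: mult_ac mult_le_cancel_right)
        then show ?thesis by (simp add: algebra_simps)
      qed
    qed
  qed
  then show ?case by (simp add: r_def)
qed

section \<open>From partial sums to the infinite sum\<close>

text \<open>
  Conditioning on \<open>Z n\<close> gives for the point probabilities the recursion that multiplication by one
  more linear factor gives for the coefficients.
\<close>
lemma prob_sum_eq_thinned_coeff:
  fixes M :: "'a measure" and Z :: "nat \<Rightarrow> 'a \<Rightarrow> nat" and p :: "nat \<Rightarrow> real"
  assumes "prob_space M"
    and p: "\<And>i. 0 \<le> p i" "\<And>i. p i \<le> 1"
    and indep: "prob_space.indep_vars M (\<lambda>_. count_space UNIV) Z UNIV"
    and distr: "\<And>i. distr M (count_space UNIV) (Z i) =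
               measure_pmf (map_pmf of_bool (bernoulli_pmf (p i)))"
  shows "measure M {\<omega> \<in> space M. (\<Sum>i<n. Z i \<omega>) = k} = thinned_coeff p 1 n k"
proof (induction n arbitrary: k)
  interpret prob_space M by fact
  case 0
  then show ?case by (auto simp: prob_space)
next
  interpret prob_space M by fact
  case (Suc n)
  have [measurable]: "Z i \<in> measurable M (count_space UNIV)" for i
    using indep by (auto simp: indep_vars_def)
  have "indep_vars (\<lambda>_. borel) (\<lambda>i \<omega>. real (Z i \<omega>)) (insert n {..<n})"
    by (rule indep_vars_subset[OF indep_vars_compose2[OF indep]]) auto
  then have iv: "indep_var borel (\<lambda>\<omega>. real (Z n \<omega>)) borel (\<lambda>\<omega>. \<Sum>i<n. real (Z i \<omega>))"
    by (intro indep_vars_sum) auto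
  have joint: "prob {\<omega> \<in> space M. Z n \<omega> = a \<and> (\<Sum>i<n. Z i \<omega>) = b}
      = prob {\<omega> \<in> space M. Z n \<omega> = a} * prob {\<omega> \<in> space M. (\<Sum>i<n. Z i \<omega>) = b}" for a b
    using prob_indep_random_variable[OF iv, of "{real a}" "{real b}"]
    by (simp flip: of_nat_sum)
  have pr: "prob {\<omega> \<in> space M. Z n \<omega> = a} = pmf (map_pmf of_bool (bernoulli_pmf (p n))) a" for a
  proof -
    have "prob {\<omega> \<in> space M. Z n \<omega> = a} = measure (distr M (count_space UNIV) (Z n)) {a}"
      by (subst measure_distr) (auto intro!: arg_cong[where f = prob])
    then show ?thesis by (simp add: distr measure_pmf_single)
  qed
  have vimage: "(of_bool :: bool \<Rightarrow> nat) -` {0} = {False}" "(of_bool :: bool \<Rightarrow> nat) -` {1} = {True}"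
    by (auto simp: of_bool_def split: if_splits)
  have p0: "prob {\<omega> \<in> space M. Z n \<omega> = 0} = 1 - p n"
   and p1: "prob {\<omega> \<in> space M. Z n \<omega> = 1} = p n"
    using p[of n] unfolding pr pmf_map vimage by (simp_all add: measure_pmf_single)
  have ae: "AE \<omega> in M. Z n \<omega> = 0 \<or> Z n \<omega> = 1"
    by (rule AE_distrD[where M' = "count_space UNIV" and f = "Z n"])
      (unfold distr, auto simp: AE_measure_pmf_iff)
  define E where "E a = {\<omega> \<in> space M. Z n \<omega> = a \<and> (\<Sum>i<n. Z i \<omega>) + a = k}" for a
  have [measurable]: "E a \<in> sets M" for a unfolding E_def by measurable
  have "prob {\<omega> \<in> space M. (\<Sum>i<Suc n. Z i \<omega>) = k} = prob (E 0 \<union> E 1)"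
    by (rule finite_measure_eq_AE) (use ae in \<open>auto simp: E_def\<close>)
  also have "\<dots> = prob (E 0) + prob (E 1)"
    by (rule finite_measure_Union) (auto simp: E_def)
  also have "prob (E 0) = (1 - p n) * thinned_coeff p 1 n k"
    using joint[of 0 k] by (simp add: E_def p0 Suc)
  also have "prob (E 1) = p n * (if k = 0 then 0 else thinned_coeff p 1 n (k - 1))"
  proof (cases k)
    case (Suc j)
    then show ?thesis using joint[of 1 j] p1 Suc.IH[of j] by (simp add: E_def)
  qed (simp add: E_def)
  finally show ?case by (simp add: thinned_coeff_Suc)
qed

text \<open>
  A convergent series of natural numbers is eventually constant, so the indicators of the events
  converge almost surely.
\<close>
lemma prob_partial_sum_tendsto:
  fixes M :: "'a measure" and Z :: "nat \<Rightarrow> 'a \<Rightarrow> nat"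
  assumes "prob_space M" and [measurable]: "\<And>i. Z i \<in> measurable M (count_space UNIV)"
    and ae: "AE \<omega> in M. (\<lambda>i. Z i \<omega>) sums (\<Sum>i. Z i \<omega>)"
  shows "(\<lambda>n. measure M {\<omega> \<in> space M. (\<Sum>i<n. Z i \<omega>) = k})
    \<longlonglongrightarrow> measure M {\<omega> \<in> space M. (\<Sum>i. Z i \<omega>) = k}"
proof -
  interpret prob_space M by fact
  note [measurable] = measurable_nat_suminf[of Z M]
  let ?A = "\<lambda>n. {\<omega> \<in> space M. (\<Sum>i<n. Z i \<omega>) = k}" and ?B = "{\<omega> \<in> space M. (\<Sum>i. Z i \<omega>) = k}"
  have "(\<lambda>n. integral\<^sup>L M (indicator (?A n) :: 'a \<Rightarrow> real)) \<longlonglongrightarrow> integral\<^sup>L M (indicator ?B)"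
  proof (rule integral_dominated_convergence[where w = "\<lambda>_. 1"])
    show "AE \<omega> in M. (\<lambda>n. indicator (?A n) \<omega> :: real) \<longlonglongrightarrow> indicator ?B \<omega>"
      using ae
    proof eventually_elim
      case (elim \<omega>)
      then obtain N where "\<And>n. n \<ge> N \<Longrightarrow> (\<Sum>i<n. Z i \<omega>) = (\<Sum>i. Z i \<omega>)"
        by (auto simp: sums_nat_iff)
      then have "eventually (\<lambda>n. indicator (?A n) \<omega> = (indicator ?B \<omega> :: real)) sequentially"
        by (auto simp: eventually_sequentially indicator_def intro!: exI[of _ N])
      then show ?case by (rule tendsto_eventually)
    qed
  qed (auto simp: indicator_def)
  then show ?thesis by simp
qed

theorem theorem1:
  fixes M :: "'a measure" and Z :: "nat \<Rightarrow> 'a \<Rightarrow> nat" and p :: "nat \<Rightarrow> real" and lam :: real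
  assumes "prob_space M"
    and "\<And>i. p i \<in> {0..<1}"
    and "p sums lam" and "0 < lam"
    and "prob_space.indep_vars M (\<lambda>_. count_space UNIV) Z UNIV"
    and "\<And>i. distr M (count_space UNIV) (Z i) =
               measure_pmf (map_pmf of_bool (bernoulli_pmf (p i)))"
  shows "max_density_ratio (bernoulli_sum_distr M Z) (measure_pmf (poisson_pmf lam))
           \<le> ennreal (inverse (1 - max_seq p))"
proof -
  interpret prob_space M by fact
  have meas [measurable]: "Z i \<in> measurable M (count_space UNIV)" for i
    using assms(5) by (auto simp: indep_vars_def)
  note [measurable] = measurable_nat_suminf[of Z M]
  define q where "q = max_seq p"
  have p: "0 \<le> p i" "p i < 1" "p i \<le> 1" for i using assms(2)[of i] by auto
  have sm: "summable p" using assms(3) by (rule sums_summable)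
  have pq: "p i \<le> q" for i using max_seq_attained(2)[of p] p sm by (simp add: q_def)
  have q: "q < 1" using max_seq_attained(1)[of p] p sm by (auto simp: q_def)
  define b where "b k = prob {\<omega> \<in> space M. (\<Sum>i. Z i \<omega>) = k}" for k
  have b_le: "b k \<le> (lam ^ k / fact k * exp (- lam)) * inverse (1 - q)" for k
  proof (rule tendsto_le[OF sequentially_bot])
    have "AE \<omega> in M. (\<lambda>i. Z i \<omega>) sums (\<Sum>i. Z i \<omega>)"
      using assms(1) meas p(1,3) sm assms(6) by (rule AE_bernoulli_sum_sums)
    from prob_partial_sum_tendsto[OF assms(1) meas this]
    show "(\<lambda>n. thinned_coeff p 1 n k) \<longlonglongrightarrow> b k"
      unfolding b_def prob_sum_eq_thinned_coeff[OF assms(1) p(1,3) assms(5,6)] .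
    have lim: "(\<lambda>n. \<Sum>i<n. p i) \<longlonglongrightarrow> lam" using assms(3) by (simp add: sums_def)
    then show "(\<lambda>n. ((\<Sum>i<n. p i) ^ k / fact k * exp (- (\<Sum>i<n. p i))) * inverse (1 - q))
        \<longlonglongrightarrow> (lam ^ k / fact k * exp (- lam)) * inverse (1 - q)"
      by (intro tendsto_intros) auto
    have "eventually (\<lambda>n. 0 < (\<Sum>i<n. p i)) sequentially"
      using lim assms(4) by (rule order_tendstoD(1))
    then show "eventually (\<lambda>n. thinned_coeff p 1 n k
        \<le> ((\<Sum>i<n. p i) ^ k / fact k * exp (- (\<Sum>i<n. p i))) * inverse (1 - q)) sequentially"
    proof eventually_elim
      case (elim n)
      then show ?case
        using thinned_ratio_bound[OF p(1) pq q refl elim, of 1 k] q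
        by (simp add: exp_minus field_simps)
    qed
  qed
  show ?thesis
    unfolding max_density_ratio_def
  proof (rule SUP_least)
    fix k
    have Q: "emeasure (bernoulli_sum_distr M Z) {k} = ennreal (b k)"
      unfolding bernoulli_sum_distr_def b_def emeasure_eq_measure[symmetric]
      by (subst emeasure_distr) (auto intro!: arg_cong[where f = "emeasure M"])
    have P: "emeasure (measure_pmf (poisson_pmf lam)) {k} = ennreal (lam ^ k / fact k * exp (- lam))"
      using assms(4) by (simp add: emeasure_pmf_single)
    have pos: "0 < lam ^ k / fact k * exp (- lam)" using assms(4) by simp
    have "b k / (lam ^ k / fact k * exp (- lam)) \<le> inverse (1 - q)"
      using b_le[of k] pos by (simp only: pos_divide_le_eq mult.commute)
    then show "emeasure (bernoulli_sum_distr M Z) {k} / emeasure (measure_pmf (poisson_pmf lam)) {k}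
        \<le> ennreal (inverse (1 - max_seq p))"
      unfolding Q P q_def[symmetric]
      by (subst divide_ennreal) (use pos in \<open>auto simp: b_def intro: ennreal_leI\<close>)
  qed
qed

end
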